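(* For real polynomials $f_2,f_3,f_4\in\mathbb{R}[x]$ with $\deg f_i\le i$ ($i=2,3,4$), put $g_{ij}=i f_i f_j'-j f_j f_i'$ for $i,j\in\{2,3,4\}$, and $$P=g_{24}^2-g_{23}g_{34},\qquad A=g_{23}\,(g_{23}f_3-2g_{24}f_2),\qquad B=g_{24}g_{34},$$ which are polynomials of degrees at most $8,9,9$, respectively. Then for the triple $$f_2=2x^2-1,\quad f_3=2x^3-x^2-2x+1,\quad f_4=x^4+x^3-2x^2+x+1$$ one has $\Phi_{8,9}(P,A,B)\ne 0$. Consequently $\Phi_{8,9}(P,A,B)$, considered as a polynomial in the coefficients of $(f_2,f_3,f_4)$, does not vanish identically.
   Context: $f'$ denotes the derivative of $f\in\mathbb{R}[x]$ with respect to $x$. A univariate polynomial is separable if it is nonzero and has no multiple root in an algebraic closure. Write $\mathbb{R}[x]_{\le d}$ for the space of polynomials of degree at most $d$. For integers $m,n\ge 2$, $\Phi_{m,n}(f,g,h)$ denotes a fixed form (homogeneous polynomial) with coefficients in $\mathbb{Z}$ in the coefficients of a triple $(f,g,h)$ of univariate polynomials with $\deg(f)\le m$ and $\deg(g),\deg(h)\le n$, having the following property: whenever $f\in\mathbb{R}[x]_{\le m}$ is separable with $\deg(f)\ge m-1$, and $g,h\in\mathbb{R}[x]_{\le n}$ are linearly independent, then $\Phi_{m,n}(f,g,h)=0$ if and only if there exists a pair $(s,t)\ne(0,0)$ of complex numbers such that $f$ and $sg+th$ have a common factor of degree at least two.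
   Formalization: In the property defining Φ_{m,n}, common factors are taken of the associated binary forms of degrees m and n, so a common zero at infinity counts when deg f = m−1; with ordinary common factors no form has the property. For deg f = m nothing changes. *)

theory Defs
  imports
    Complex_Main
    "HOL-Computational_Algebra.Computational_Algebra"
    "HOL-Library.Poly_Mapping"
    "HOL-Library.Nat_Bijection"
begin

section \<open>Multivariate integer polynomials\<close>

text \<open>A monomial is a finitely supported map from variables to exponents; a polynomial is a
  finitely supported map from monomials to coefficients.\<close>

type_synonym 'v int_mpoly = "('v \<Rightarrow>\<^sub>0 nat) \<Rightarrow>\<^sub>0 int"

definition mpoly_eval :: "('v \<Rightarrow> 'a::comm_ring_1) \<Rightarrow> 'v int_mpoly \<Rightarrow> 'a" where
  "mpoly_eval a p = (\<Sum>M \<in> Poly_Mapping.keys p. of_int (Poly_Mapping.lookup p M) *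
      (\<Prod>v \<in> Poly_Mapping.keys M. a v ^ Poly_Mapping.lookup M v))"

definition mpoly_vars :: "'v int_mpoly \<Rightarrow> 'v set" where
  "mpoly_vars p = (\<Union>M \<in> Poly_Mapping.keys p. Poly_Mapping.keys M)"

definition mpoly_homogeneous :: "'v int_mpoly \<Rightarrow> bool" where
  "mpoly_homogeneous p \<longleftrightarrow>
    (\<exists>d. \<forall>M \<in> Poly_Mapping.keys p. (\<Sum>v \<in> Poly_Mapping.keys M. Poly_Mapping.lookup M v) = d)"

definition mpoly_var :: "'v \<Rightarrow> 'v int_mpoly" where
  "mpoly_var v = Poly_Mapping.single (Poly_Mapping.single v 1) 1"


section \<open>Forms in the coefficients of a triple of univariate polynomials\<close>

text \<open>\<open>CF k\<close>, \<open>CG k\<close>, \<open>CH k\<close> stand for the coefficient of \<open>x^k\<close> in the first, second and third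
  polynomial of the triple.\<close>

datatype coef_var = CF nat | CG nat | CH nat

type_synonym triple_form = "coef_var int_mpoly"

definition is_triple_form :: "nat \<Rightarrow> nat \<Rightarrow> triple_form \<Rightarrow> bool" where
  "is_triple_form m n \<Phi> \<longleftrightarrow>
    mpoly_homogeneous \<Phi> \<and> mpoly_vars \<Phi> \<subseteq> CF ` {..m} \<union> CG ` {..n} \<union> CH ` {..n}"

definition triple_form_eval ::
  "triple_form \<Rightarrow> 'a::comm_ring_1 poly \<Rightarrow> 'a poly \<Rightarrow> 'a poly \<Rightarrow> 'a" where
  "triple_form_eval \<Phi> f g h =
    mpoly_eval (\<lambda>v. case v of CF k \<Rightarrow> coeff f k | CG k \<Rightarrow> coeff g k | CH k \<Rightarrow> coeff h k) \<Phi>"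


section \<open>The defining property of the form\<close>

abbreviation cpoly :: "real poly \<Rightarrow> complex poly" where
  "cpoly \<equiv> map_poly complex_of_real"

definition separable_poly :: "real poly \<Rightarrow> bool" where
  "separable_poly f \<longleftrightarrow> rsquarefree (cpoly f)"

definition lin_indep2 :: "real poly \<Rightarrow> real poly \<Rightarrow> bool" where
  "lin_indep2 g h \<longleftrightarrow> (\<forall>a b. smult a g + smult b h = 0 \<longrightarrow> a = 0 \<and> b = 0)"

text \<open>A polynomial of degree at most \<open>m\<close> is regarded as a binary form of degree \<open>m\<close> (its
  \<open>m\<close>-homogenization), so common factors are counted together with the zero at infinity: a form
  \<open>q\<close> of degree \<open>k\<close> divides \<open>f\<close> if \<open>f = q * r\<close> for a form \<open>r\<close> of degree \<open>m - k\<close>.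

  If \<open>f\<close> has degree exactly \<open>m\<close>, this is the ordinary notion of a common factor of degree at
  least two (lemma \<open>common_form_factor2_iff\<close> below). For \<open>deg f = m - 1\<close> the zero at infinity cannot
  be ignored, because no form would have the required property then. Let \<open>a\<close> be a real root of
  a separable such \<open>f\<close>, and for \<open>c \<noteq> 0\<close> small replace \<open>f\<close> by \<open>(1 - c * x) * f\<close> and \<open>(g, h) = (x - a, 1)\<close> by
  \<open>((1 - c * x) * (x - a), 1)\<close>. The new pair has a common factor of degree two, so every admissible
  form vanishes there, hence, letting \<open>c\<close> tend to 0, also at \<open>(f, x - a, 1)\<close>, where \<open>s * g + t * h\<close>
  has degree at most one.\<close>

definition common_form_factor2 :: "nat \<Rightarrow> nat \<Rightarrow> complex poly \<Rightarrow> complex poly \<Rightarrow> bool" where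
  "common_form_factor2 m n f u \<longleftrightarrow>
    (\<exists>k q r r'. 2 \<le> k \<and> k \<le> m \<and> k \<le> n \<and> degree q \<le> k \<and>
       degree r \<le> m - k \<and> f = q * r \<and> degree r' \<le> n - k \<and> u = q * r')"

lemma common_form_factor2_iff:
  assumes "f \<noteq> 0" "degree f = m" "u \<noteq> 0" "degree u \<le> n"
  shows "common_form_factor2 m n f u \<longleftrightarrow> (\<exists>q. 2 \<le> degree q \<and> q dvd f \<and> q dvd u)"
proof
  assume "common_form_factor2 m n f u"
  then obtain k q r r' where *: "2 \<le> k" "k \<le> m" "degree q \<le> k" "degree r \<le> m - k"
    "f = q * r" "u = q * r'"
    unfolding common_form_factor2_def by blast
  with assms have "degree q + degree r = m"
    by (metis degree_mult_eq mult_eq_0_iff)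
  with * have "2 \<le> degree q" by linarith
  with * show "\<exists>q. 2 \<le> degree q \<and> q dvd f \<and> q dvd u" by auto
next
  assume "\<exists>q. 2 \<le> degree q \<and> q dvd f \<and> q dvd u"
  then obtain q r r' where *: "2 \<le> degree q" "f = q * r" "u = q * r'"
    by (auto elim!: dvdE)
  with assms have "degree q + degree r = m" "degree q + degree r' \<le> n"
    by (metis degree_mult_eq mult_eq_0_iff)+
  with * show "common_form_factor2 m n f u"
    unfolding common_form_factor2_def
    by (intro exI[of _ "degree q"] exI[of _ q] exI[of _ r] exI[of _ r']) auto
qed

definition is_Phi :: "nat \<Rightarrow> nat \<Rightarrow> triple_form \<Rightarrow> bool" where
  "is_Phi m n \<Phi> \<longleftrightarrow> is_triple_form m n \<Phi> \<and>
    (\<forall>f g h :: real poly.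
       degree f \<le> m \<and> m - 1 \<le> degree f \<and> separable_poly f \<and>
       degree g \<le> n \<and> degree h \<le> n \<and> lin_indep2 g h \<longrightarrow>
       (triple_form_eval \<Phi> f g h = 0 \<longleftrightarrow>
        (\<exists>s t :: complex. (s, t) \<noteq> (0, 0) \<and>
           common_form_factor2 m n (cpoly f) (smult s (cpoly g) + smult t (cpoly h)))))"


section \<open>The polynomials \<open>P\<close>, \<open>A\<close>, \<open>B\<close>\<close>

definition gpoly :: "nat \<Rightarrow> nat \<Rightarrow> 'a::idom poly \<Rightarrow> 'a poly \<Rightarrow> 'a poly" where
  "gpoly i j fi fj = of_nat i * fi * pderiv fj - of_nat j * fj * pderiv fi"

definition polyP :: "'a::idom poly \<Rightarrow> 'a poly \<Rightarrow> 'a poly \<Rightarrow> 'a poly" where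
  "polyP f2 f3 f4 = (gpoly 2 4 f2 f4)\<^sup>2 - gpoly 2 3 f2 f3 * gpoly 3 4 f3 f4"

definition polyA :: "'a::idom poly \<Rightarrow> 'a poly \<Rightarrow> 'a poly \<Rightarrow> 'a poly" where
  "polyA f2 f3 f4 = gpoly 2 3 f2 f3 * (gpoly 2 3 f2 f3 * f3 - 2 * gpoly 2 4 f2 f4 * f2)"

definition polyB :: "'a::idom poly \<Rightarrow> 'a poly \<Rightarrow> 'a poly \<Rightarrow> 'a poly" where
  "polyB f2 f3 f4 = gpoly 2 4 f2 f4 * gpoly 3 4 f3 f4"

text \<open>The polynomial of degree \<open>i\<close> with indeterminate coefficients. The coefficient of \<open>x^k\<close> in
  \<open>generic_poly i\<close> is the variable numbered \<open>prod_encode (i, k)\<close>; variables are numbered by \<open>nat\<close>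
  because the library makes the polynomial ring an integral domain only for linearly ordered
  variables, and \<open>pderiv\<close> requires a ring without zero divisors.\<close>

definition generic_poly :: "nat \<Rightarrow> nat int_mpoly poly" where
  "generic_poly i = (\<Sum>k\<le>i. monom (mpoly_var (prod_encode (i, k))) k)"

end

theory Submission
  imports Defs
begin

text \<open>All common factors are read off the roots of \<open>P = 4 p\<close>, with \<open>p\<close> squarefree of degree 8. As \<open>B\<close> is
  a unit modulo \<open>p\<close>, the quotient \<open>A / B\<close> is congruent modulo \<open>p\<close> to a polynomial \<open>C / 1690072\<close>. If
  \<open>P\<close> and \<open>s A + t B\<close> had a common factor of degree two, then \<open>C\<close> would take the same value at two
  distinct roots of \<open>p\<close>. But the powers of \<open>C\<close> span \<open>\<rat>[x]/(p)\<close>: some polynomial in \<open>C\<close> is congruent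
  to \<open>x\<close>, so \<open>C\<close> separates the roots. For the generic polynomials, specialize the coefficients.\<close>

section \<open>Degree bounds\<close>

text \<open>In the convolution only the index \<open>i = m\<close> survives: below it the index into
  \<open>q\<close> exceeds \<open>n\<close>, above it \<open>coeff p i\<close> vanishes.\<close>

lemma coeff_mult_at_degree_bounds:
  fixes p q :: "'a::comm_semiring_0 poly"
  assumes "degree p \<le> m" "degree q \<le> n"
  shows "coeff (p * q) (m + n) = coeff p m * coeff q n"
proof -
  have "coeff p i * coeff q (m + n - i) = 0" if "i \<le> m + n" "i \<noteq> m" for i
  proof (cases "i < m")
    case True
    then have "coeff q (m + n - i) = 0"
      using assms by (intro coeff_eq_0) auto
    then show ?thesis by simp
  next
    case False
    then have "coeff p i = 0"
      using that assms by (intro coeff_eq_0) auto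
    then show ?thesis by simp
  qed
  then have "(\<Sum>i\<le>m + n. coeff p i * coeff q (m + n - i)) =
      (\<Sum>i\<in>{m}. coeff p i * coeff q (m + n - i))"
    by (intro sum.mono_neutral_right) auto
  then show ?thesis
    by (simp add: coeff_mult)
qed

text \<open>The obvious bound is \<open>i + j + 1\<close>, but there the two products contribute the
  same value with opposite signs. Successor indices avoid truncated subtraction.\<close>

lemma degree_gpoly_le:
  fixes p q :: "'a::{idom,semiring_char_0} poly"
  assumes "degree p \<le> Suc i" "degree q \<le> Suc j"
  shows "degree (gpoly (Suc i) (Suc j) p q) \<le> i + j"
proof -
  have dp: "degree (pderiv p) \<le> i" and dq: "degree (pderiv q) \<le> j"
    using assms by (simp_all add: degree_pderiv)
  have eq: "gpoly (Suc i) (Suc j) p q =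
      smult (of_nat (Suc i)) (p * pderiv q) - smult (of_nat (Suc j)) (q * pderiv p)"
    by (simp only: gpoly_def of_nat_poly mult_pCons_left smult_0_left) simp
  have "degree (p * pderiv q) \<le> Suc (i + j)" "degree (q * pderiv p) \<le> Suc (i + j)"
    using degree_mult_le[of p "pderiv q"] degree_mult_le[of q "pderiv p"] assms dp dq by linarith+
  then have "degree (gpoly (Suc i) (Suc j) p q) \<le> Suc (i + j)"
    unfolding eq by (meson degree_diff_le degree_smult_le order_trans)
  moreover have "coeff (gpoly (Suc i) (Suc j) p q) (Suc (i + j)) = 0"
    using coeff_mult_at_degree_bounds[OF assms(1) dq] coeff_mult_at_degree_bounds[OF assms(2) dp]
    by (simp add: eq coeff_pderiv add.commute mult_ac)
  ultimately show ?thesis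
    using eq_zero_or_degree_less[of "gpoly (Suc i) (Suc j) p q" "Suc (i + j)"] by auto
qed

lemma degree_polyP_polyA_polyB_le:
  fixes f2 f3 f4 :: "'a::{idom,semiring_char_0} poly"
  assumes "degree f2 \<le> 2" "degree f3 \<le> 3" "degree f4 \<le> 4"
  shows "degree (polyP f2 f3 f4) \<le> 8" "degree (polyA f2 f3 f4) \<le> 9" "degree (polyB f2 f3 f4) \<le> 9"
proof -
  have mult: "degree (p * q) \<le> m + n" if "degree p \<le> m" "degree q \<le> n"
    for p q :: "'a poly" and m n
    using degree_mult_le[of p q] that by linarith
  have g23: "degree (gpoly 2 3 f2 f3) \<le> 3"
    using degree_gpoly_le[of f2 1 f3 2] assms by (simp add: eval_nat_numeral)
  have g24: "degree (gpoly 2 4 f2 f4) \<le> 4"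
    using degree_gpoly_le[of f2 1 f4 3] assms by (simp add: eval_nat_numeral)
  have g34: "degree (gpoly 3 4 f3 f4) \<le> 5"
    using degree_gpoly_le[of f3 2 f4 3] assms by (simp add: eval_nat_numeral)
  show "degree (polyP f2 f3 f4) \<le> 8"
    unfolding polyP_def power2_eq_square
    using mult[OF g24 g24] mult[OF g23 g34] by (intro degree_diff_le) simp_all
  \<comment> \<open>The numeral 2 is itself a constant polynomial, hence the summand 0.\<close>
  have "degree (2 * gpoly 2 4 f2 f4) \<le> 0 + 4"
    by (rule mult[OF _ g24]) simp
  then have "degree (gpoly 2 3 f2 f3 * f3 - 2 * gpoly 2 4 f2 f4 * f2) \<le> 6"
    using mult[OF g23 assms(2)] mult[of "2 * gpoly 2 4 f2 f4" 4 f2 2] assms(1)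
    by (intro degree_diff_le) simp_all
  then show "degree (polyA f2 f3 f4) \<le> 9"
    unfolding polyA_def using mult[OF g23] by force
  show "degree (polyB f2 f3 f4) \<le> 9"
    unfolding polyB_def using mult[OF g24 g34] by simp
qed


section \<open>Specialization of coefficients\<close>

definition ring_hom_fun :: "('a::comm_ring_1 \<Rightarrow> 'b::comm_ring_1) \<Rightarrow> bool" where
  "ring_hom_fun h \<longleftrightarrow>
    h 1 = 1 \<and> (\<forall>x y. h (x + y) = h x + h y) \<and> (\<forall>x y. h (x * y) = h x * h y)"

context
  fixes h :: "'a::comm_ring_1 \<Rightarrow> 'b::comm_ring_1"
  assumes h: "ring_hom_fun h"
begin

lemma hom_simps:
  "h 1 = 1" "h (x + y) = h x + h y" "h (x * y) = h x * h y" "h 0 = 0" "h (- x) = - h x"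
  "h (x - y) = h x - h y"
proof -
  have add: "h (x + y) = h x + h y" for x y
    using h by (simp add: ring_hom_fun_def)
  show "h 1 = 1" "h (x + y) = h x + h y" "h (x * y) = h x * h y"
    using h by (simp_all add: ring_hom_fun_def)
  show zero: "h 0 = 0"
    using add[of 0 0] by simp
  show minus: "h (- x) = - h x" for x
    using add[of x "- x"] zero by (simp add: eq_neg_iff_add_eq_0 add.commute)
  show "h (x - y) = h x - h y"
    using add[of x "- y"] minus by simp
qed

lemma hom_sum: "h (sum f S) = (\<Sum>x\<in>S. h (f x))"
  by (induction S rule: infinite_finite_induct) (simp_all add: hom_simps)

lemma hom_prod: "h (prod f S) = (\<Prod>x\<in>S. h (f x))"
  by (induction S rule: infinite_finite_induct) (simp_all add: hom_simps)

lemma hom_power: "h (x ^ n) = h x ^ n"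
  by (induction n) (simp_all add: hom_simps)

lemma hom_of_nat: "h (of_nat n) = of_nat n"
  by (induction n) (simp_all add: hom_simps)

lemma hom_of_int: "h (of_int n) = of_int n"
  by (cases n rule: int_cases2) (simp_all add: hom_simps hom_of_nat)

lemma hom_mpoly_eval: "h (mpoly_eval a p) = mpoly_eval (\<lambda>v. h (a v)) p"
  by (simp add: mpoly_eval_def hom_sum hom_prod hom_power hom_of_int hom_simps)

text \<open>This lets every fact of the context be applied a second time, to
  \<open>map_poly h\<close> in place of \<open>h\<close>.\<close>

lemma ring_hom_fun_map_poly: "ring_hom_fun (map_poly h)"
  unfolding ring_hom_fun_def
  by (auto intro!: poly_eqI simp: coeff_map_poly coeff_mult hom_sum hom_simps)

text \<open>Forms have integer coefficients, and \<open>h\<close> respects integers; so evaluating a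
  form commutes with specializing the triple.\<close>

lemma hom_triple_form_eval:
  "h (triple_form_eval \<Phi> f g k) = triple_form_eval \<Phi> (map_poly h f) (map_poly h g) (map_poly h k)"
  unfolding triple_form_eval_def hom_mpoly_eval
  by (intro arg_cong[where f = "\<lambda>a. mpoly_eval a \<Phi>"])
    (auto simp: fun_eq_iff coeff_map_poly hom_simps split: coef_var.split)

end

context
  fixes h :: "'a::idom \<Rightarrow> 'b::idom"
  assumes h: "ring_hom_fun h"
begin

text \<open>Differentiation only shifts coefficients and multiplies them by natural numbers, which
  \<open>h\<close> respects.\<close>

lemma map_poly_pderiv: "map_poly h (pderiv p) = pderiv (map_poly h p)"
  by (intro poly_eqI) (simp add: coeff_map_poly coeff_pderiv hom_simps[OF h] hom_of_nat[OF h]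
      flip: of_nat_Suc)

lemma map_poly_gpoly: "map_poly h (gpoly i j p q) = gpoly i j (map_poly h p) (map_poly h q)"
  using ring_hom_fun_map_poly[OF h]
  by (simp add: gpoly_def hom_simps hom_of_nat map_poly_pderiv)

lemma map_poly_polyP_polyA_polyB:
  "map_poly h (polyP p q r) = polyP (map_poly h p) (map_poly h q) (map_poly h r)"
  "map_poly h (polyA p q r) = polyA (map_poly h p) (map_poly h q) (map_poly h r)"
  "map_poly h (polyB p q r) = polyB (map_poly h p) (map_poly h q) (map_poly h r)"
  using ring_hom_fun_map_poly[OF h] hom_of_nat[OF ring_hom_fun_map_poly[OF h], of 2]
  by (simp_all add: polyP_def polyA_def polyB_def hom_simps hom_power map_poly_gpoly)

end

section \<open>Evaluation of integer polynomials is a ring homomorphism\<close>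

definition monom_eval :: "('v \<Rightarrow> 'a::comm_ring_1) \<Rightarrow> ('v \<Rightarrow>\<^sub>0 nat) \<Rightarrow> 'a" where
  "monom_eval a M = (\<Prod>v \<in> Poly_Mapping.keys M. a v ^ Poly_Mapping.lookup M v)"

lemma monom_eval_superset:
  assumes "finite V" "Poly_Mapping.keys M \<subseteq> V"
  shows "monom_eval a M = (\<Prod>v\<in>V. a v ^ Poly_Mapping.lookup M v)"
  unfolding monom_eval_def using assms
  by (intro prod.mono_neutral_left) (auto simp: in_keys_iff)

lemma monom_eval_add: "monom_eval a (M + N) = monom_eval a M * monom_eval a N"
proof -
  let ?V = "Poly_Mapping.keys M \<union> Poly_Mapping.keys N"
  have "Poly_Mapping.keys (M + N) \<subseteq> ?V"
    by (rule keys_add)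
  then show ?thesis
    by (simp add: monom_eval_superset[of ?V] lookup_add power_add prod.distrib)
qed

text \<open>Terms may cancel in a sum, so its keys need not be the union of the keys. Over a common
  finite superset the extra terms have coefficient zero.\<close>

lemma mpoly_eval_superset:
  assumes "finite K" "Poly_Mapping.keys p \<subseteq> K"
  shows "mpoly_eval a p = (\<Sum>M\<in>K. of_int (Poly_Mapping.lookup p M) * monom_eval a M)"
  unfolding mpoly_eval_def monom_eval_def using assms
  by (intro sum.mono_neutral_left) (auto simp: in_keys_iff)

lemma mpoly_eval_add: "mpoly_eval a (p + q) = mpoly_eval a p + mpoly_eval a q"
proof -
  let ?K = "Poly_Mapping.keys p \<union> Poly_Mapping.keys q"
  have "Poly_Mapping.keys (p + q) \<subseteq> ?K"
    by (rule keys_add)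
  then show ?thesis
    by (simp add: mpoly_eval_superset[of ?K] lookup_add distrib_right sum.distrib)
qed

lemma mpoly_eval_single: "mpoly_eval a (Poly_Mapping.single M c) = of_int c * monom_eval a M"
  by (simp add: mpoly_eval_superset[of "{M}"])

lemma mpoly_eval_sum: "mpoly_eval a (sum f S) = (\<Sum>x\<in>S. mpoly_eval a (f x))"
  by (induction S rule: infinite_finite_induct) (simp_all add: mpoly_eval_add mpoly_eval_superset[of "{}"])

lemma int_mpoly_sum_singles:
  "p = (\<Sum>M\<in>Poly_Mapping.keys p. Poly_Mapping.single M (Poly_Mapping.lookup p M))"
  by (rule poly_mapping_eqI) (auto simp: lookup_sum lookup_single when_def in_keys_iff)

text \<open>Expanding both factors into single terms reduces the claim to monomials, where exponents
  add.\<close>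

lemma mpoly_eval_mult: "mpoly_eval a (p * q) = mpoly_eval a p * mpoly_eval a q"
proof -
  let ?s = "\<lambda>p M. Poly_Mapping.single M (Poly_Mapping.lookup p M)"
  have "p * q = (\<Sum>M\<in>Poly_Mapping.keys p. \<Sum>N\<in>Poly_Mapping.keys q. ?s p M * ?s q N)"
    by (subst (1) int_mpoly_sum_singles[of p], subst (1) int_mpoly_sum_singles[of q])
      (simp only: sum_product)
  then have "mpoly_eval a (p * q) =
      (\<Sum>M\<in>Poly_Mapping.keys p. \<Sum>N\<in>Poly_Mapping.keys q. mpoly_eval a (?s p M) * mpoly_eval a (?s q N))"
    by (simp add: mpoly_eval_sum mult_single mpoly_eval_single monom_eval_add mult_ac)
  then show ?thesis
    unfolding sum_product[symmetric] mpoly_eval_sum[symmetric] int_mpoly_sum_singles[symmetric] .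
qed

lemma ring_hom_fun_mpoly_eval: "ring_hom_fun (mpoly_eval a)"
proof -
  have "mpoly_eval a 1 = 1"
    using mpoly_eval_single[of a 0 1] by (simp add: monom_eval_def)
  then show ?thesis
    by (simp add: ring_hom_fun_def mpoly_eval_add mpoly_eval_mult)
qed

lemma mpoly_eval_var: "mpoly_eval a (mpoly_var v) = a v"
  by (simp add: mpoly_var_def mpoly_eval_single monom_eval_def)

lemma coeff_generic_poly:
  "coeff (generic_poly i) k = (if k \<le> i then mpoly_var (prod_encode (i, k)) else 0)"
  by (simp add: generic_poly_def coeff_sum)

lemma map_poly_generic_poly:
  assumes "degree f \<le> i" "\<And>k. k \<le> i \<Longrightarrow> a (prod_encode (i, k)) = coeff f k"
  shows "map_poly (mpoly_eval a) (generic_poly i) = f"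
proof (rule poly_eqI)
  fix k
  show "coeff (map_poly (mpoly_eval a) (generic_poly i)) k = coeff f k"
    using assms hom_simps(4)[OF ring_hom_fun_mpoly_eval, of a]
    by (auto simp: coeff_map_poly coeff_generic_poly mpoly_eval_var coeff_eq_0)
qed


section \<open>The special triple\<close>

abbreviation f2_special :: "real poly" where "f2_special \<equiv> [:-1, 0, 2:]"
abbreviation f3_special :: "real poly" where "f3_special \<equiv> [:1, -2, -1, 2:]"
abbreviation f4_special :: "real poly" where "f4_special \<equiv> [:1, 1, -2, 1, 1:]"

definition p_special :: "complex poly" where
  "p_special = [:-10, 32, 21, 71, 10, -10, 45, -13, 14:]"

definition A_special :: "complex poly" where
  "A_special = [:0, -128, 208, 208, -512, -208, 704, -160, -16, 96:]"

definition B_special :: "complex poly" where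
  "B_special = [:-22, -84, -178, 180, 122, 316, -198, 316, -108, 40:]"

lemma gpoly_special:
  "gpoly 2 3 f2_special f3_special = [:4, -8, 4, 4:]"
  "gpoly 2 4 f2_special f4_special = [:-2, -8, -18, 8, -4:]"
  "gpoly 3 4 f3_special f4_special = [:11, -2, -2, -20, 7, -10:]"
  by (simp_all add: gpoly_def pderiv_pCons numeral_poly)

lemma polyP_special: "polyP f2_special f3_special f4_special = [:-40, 128, 84, 284, 40, -40,
    180, -52, 56:]"
  unfolding polyP_def gpoly_special power2_eq_square by simp

lemma polyA_special: "polyA f2_special f3_special f4_special = [:0, -128, 208, 208, -512, -208,
    704, -160, -16, 96:]"
  unfolding polyA_def gpoly_special by (simp add: numeral_poly)

lemma polyB_special: "polyB f2_special f3_special f4_special = [:-22, -84, -178, 180, 122, 316,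
    -198, 316, -108, 40:]"
  unfolding polyB_def gpoly_special by simp

lemma cpoly_special:
  "cpoly (polyP f2_special f3_special f4_special) = smult 4 p_special"
  "cpoly (polyA f2_special f3_special f4_special) = A_special"
  "cpoly (polyB f2_special f3_special f4_special) = B_special"
  by (simp_all add: polyP_special polyA_special polyB_special map_poly_pCons
      p_special_def A_special_def B_special_def)

section \<open>Bezout certificates for \<open>p_special\<close>\<close>

lemma pderiv_p: "pderiv p_special = [:32, 42, 213, 40, -50, 270, -91, 112:]"
  by (simp add: p_special_def pderiv_pCons)

text \<open>An extended Euclidean identity, cleared of denominators. The nonzero constant on the
  right rules out a common root of \<open>p_special\<close> and its derivative.\<close>

lemma bezout_p_pderiv:
  "[:-90465950429250363248, -127973673537846564508, -2219013365561777828,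
      -32848181409693110327, -130637732295820993238, 30414789885522233093,
      -65001150419452115344:] * p_special
    + [:15682597370509104260, 29890768399880112498, 43029589558010186934,
        1617997279416982775, 4293586226467008269, 22533869611706437149,
        -4744945784186794203, 8125143802431514418:] * pderiv p_special
    = [:1406502620148794968800:]"
  unfolding pderiv_p by (simp add: p_special_def)

text \<open>Up to the constant, the first cofactor inverts \<open>B_special\<close> modulo
  \<open>p_special\<close>; its product with \<open>A_special\<close>, reduced modulo
  \<open>p_special\<close>, is a scalar multiple of \<open>C1\<close>.\<close>

lemma bezout_B_p:
  "[:-3945165272098268, -7485169414945194, -12098867018857878, 97968361175629,
      -1266879205596695, -6088930525123293, 1322726809739709, -2234000355805526:] * B_special
    + [:-23352313445002780, -25120642025504018, 30290959654257436, 42014290432621040,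
        30807839997741948, -11359717280716178, 43500660981426908, -15085996767414892,
        6382858159444360:] * p_special
    = [:320316770436189696:]"
  by (simp add: p_special_def B_special_def)

lemma rsquarefree_p: "rsquarefree p_special"
proof -
  have False if "poly p_special z = 0" "poly (pderiv p_special) z = 0" for z
    using arg_cong[OF bezout_p_pderiv, of "\<lambda>q. poly q z"]
    by (simp only: poly_add poly_mult that) simp
  then show ?thesis
    by (auto simp: rsquarefree_roots)
qed

lemma B_nonzero_at_roots_p:
  assumes "poly p_special z = 0"
  shows "poly B_special z \<noteq> 0"
proof
  assume "poly B_special z = 0"
  then show False
    using arg_cong[OF bezout_B_p, of "\<lambda>q. poly q z"]
    by (simp only: poly_add poly_mult assms) simp
qed

section \<open>Separating the roots of \<open>p_special\<close> by the values of A / B\<close>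

text \<open>\<open>C\<^sub>i\<close> is congruent to a constant multiple of \<open>C1 ^ i\<close> modulo \<open>p_special\<close>, and \<open>C1 / 1690072\<close>
  represents \<open>A_special / B_special\<close>. The coefficients below come from linear algebra over the
  rationals in the basis \<open>1, x, \<dots>, x^7\<close>.\<close>

definition C1 :: "complex poly" where
  "C1 = [:1374570, -5407516, 8893453, 1875699, -4641567, 5747905, -2710616, 1544788:]"

definition C2 :: "complex poly" where
  "C2 = [:-90865513660, 298725201922, 369916950586, -91917077197, 101843381799, 112451367085,
      -3700670537, 53782994510:]"

definition C3 :: "complex poly" where
  "C3 = [:-612189749350430, 8153157032392316, -22872361471390695, -2214034918190085,
      7642278294221209, -12631174558724775, 5127806193477756, -4002017173762132:]"

definition C4 :: "complex poly" where
  "C4 = [:206962926244120176060, -761293393562381283942, -430498173490407479946,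
      233973596927743341035, -293867856959808126649, -39094590628137382971,
      -86719232414183533293, -37808160382307156842:]"

definition C5 :: "complex poly" where
  "C5 = [:-2153338331996727508755430, -4790433624448279214808364, 56062886030158711134768181,
      3863114040680878964106995, -11627345555659795808654407, 26212887644632104507532273,
      -7866710714898032762833544, 9130415703504310486010292:]"

definition C6 :: "complex poly" where
  "C6 = [:-403607893517044365940858355180, 1689238959029093686717657097746,
      30878101288945544845731557794, -619527069704409882997834679741,
      701241261088352046043986518567, -298797531218042279763233275715,
      327865013552773606257872786527, -114540294544140448398555088130:]"

definition C7 :: "complex poly" where
  "C7 = [:11937959760602464113362776067194770, -19546467672716312526873131866696084,
      -122059895568699497724029375790248463, -6840331123110756308231929522308181,
      16039977719827278949845581093022297, -46752304863021525040548019088825271,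
      4826551334747015562934683778135956, -16116291210861512184731198871784580:]"

lemma A_congruent_C_B:
  "smult 1690072 A_special = C1 * B_special + p_special *
    [:-3024054, 12306096, -734312, 9033224, -46168246, 47004616, -43562812, 15563136, -4413680:]"
  by (simp add: A_special_def B_special_def p_special_def C1_def)

text \<open>Division with remainder by \<open>p_special\<close>: the list is the quotient, and the
  factor 172 of the remainder is split off to limit the growth of the integers. The next five lemmas
  follow the same scheme.\<close>

lemma C_step_1:
  "C1 * C1 = smult 172 C2 + p_special *
    [:-1751831103442, 1018815795668, 574879111921, -937206269513, 836908879990,
        -439909940812, 170454997496:]"
  by (simp add: p_special_def C1_def C2_def)

lemma C_step_2:
  "C1 * C2 = smult 172 C3 + p_special *
    [:1960437222335224, 56310158091561342, -17595919119468118, 1823704062233103,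
        11199182277530805, -5310928252952704, 5934523180222420:]"
  by (simp add: p_special_def C1_def C2_def C3_def)

lemma C_step_3:
  "C1 * C3 = smult 172 C4 + p_special *
    [:3643912097775329084742, -2885478749058299576228, -888638198310045780243,
        1792899173210859557439, -1746116242979612676230, 930616266475009695012,
        -441590578987261169144:]"
  by (simp add: p_special_def C1_def C3_def C4_def)

lemma C_step_4:
  "C1 * C4 = smult 172 C5 + p_special *
    [:-65485922263081740191272816, -75389770076277751163234682, 48956799787898004049101814,
        -26882443125554092852252537, 4678100922616295624744833, -6122370683396630548683696,
        -4171828032904536300259964:]"
  by (simp add: p_special_def C1_def C4_def C5_def)

lemma C_step_5:
  "C1 * C5 = smult 172 C6 + p_special *
    [:-6646064341391888921011768567586, 7281561689193592385212443174116,
        1493756183375789436087841097177, -3322288749489256210102622798025,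
        3346973012224776925593421875686, -1700311637156214153468847079308,
        1007468329556072627647347639864:]"
  by (simp add: p_special_def C1_def C5_def C6_def)

lemma C_step_6:
  "C1 * C6 = smult 172 C7 + p_special *
    [:260811638101534750158972315283727304, 47948664170957125997839888178929518,
        -130128996570619435700781202060992078, 93632019470523549428582064635328479,
        -59563419031920261420612621181075715, 46618201874611267835476488069452384,
        -12638605180589545357193365534440460:]"
  by (simp add: p_special_def C1_def C6_def C7_def)

text \<open>All terms have degree at most 7, so the congruence with a multiple of \<open>x\<close>
  is an equality. The weights solve an 8 by 8 linear system; the large factor on the right clears
  denominators.\<close>

lemma C_comb:
  "[:-17124914804146828581033539368579759522553150798017673305438681451069440:] +
   smult 80822295054277823252222230878579158430698518272084245609822401536 C1 +
   smult (-3633615979116479123506959611821554542258757337848785043545216) C2 +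
   smult 187544194771399410929149263337235602165714272012061865440 C3 +
   smult (-656412865412101849598771791528738598387047093428376) C4 +
   smult 137294887219271441467948149212996936968472207705 C5 +
   smult 443308366964448319870347057476776805171340 C6 +
   smult 25221184941841763758712333385692469211 C7
   = [:0, 104466171647641279612281405526247273308063258092927077659327959190732800:]"
  by (simp add: C1_def C2_def C3_def C4_def C5_def C6_def C7_def)

lemma C_separates_roots_p:
  assumes "poly p_special a = 0" "poly p_special b = 0" "poly C1 a = poly C1 b"
  shows "a = b"
proof -
  \<comment> \<open>At \<open>a\<close> and \<open>b\<close> the multiple of
    \<open>p_special\<close> vanishes, and 172 can be cancelled.\<close>
  have step: "poly G a = poly G b"
    if "C1 * F = smult 172 G + p_special * Q" "poly F a = poly F b" for F G Q
    using arg_cong[OF that(1), of "\<lambda>q. poly q a"] arg_cong[OF that(1), of "\<lambda>q. poly q b"] that(2) assms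
    by (simp only: poly_add poly_mult poly_smult) simp
  note 1 = assms(3)
  note 2 = step[OF C_step_1 1]
  note 3 = step[OF C_step_2 2]
  note 4 = step[OF C_step_3 3]
  note 5 = step[OF C_step_4 4]
  note 6 = step[OF C_step_5 5]
  note 7 = step[OF C_step_6 6]
  have "poly [:0, 104466171647641279612281405526247273308063258092927077659327959190732800:] a =
      poly [:0, 104466171647641279612281405526247273308063258092927077659327959190732800:] b"
    unfolding C_comb[symmetric] poly_add poly_smult poly_pCons poly_0 mult_zero_right 1 2 3 4 5 6 7 ..
  then show ?thesis by simp
qed

text \<open>On the roots of \<open>q\<close> the value of \<open>C1\<close> is determined by
  \<open>s\<close> and \<open>t\<close>. Since \<open>C1\<close> separates the roots of
  \<open>p_special\<close>, \<open>q\<close> has only one root, which is then multiple, against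
  squarefreeness.\<close>

lemma no_common_factor_special:
  assumes "(s, t) \<noteq> (0, 0)" "2 \<le> degree q" "q dvd p_special"
    "q dvd smult s A_special + smult t B_special"
  shows False
proof -
  have dvd_root: "poly p_special z = 0 \<and> s * poly C1 z = - t * 1690072" if "poly q z = 0" for z
  proof -
    have p: "poly p_special z = 0"
      using assms(3) that by (metis dvdE mult_zero_left poly_mult)
    have "poly (smult s A_special + smult t B_special) z = 0"
      using assms(4) that by (metis dvdE mult_zero_left poly_mult)
    then have "s * poly A_special z + t * poly B_special z = 0"
      by simp
    moreover have "1690072 * poly A_special z = poly C1 z * poly B_special z"
      using arg_cong[OF A_congruent_C_B, of "\<lambda>q. poly q z"] p
      by (simp only: poly_add poly_mult poly_smult) simp
    \<comment> \<open>Here \<open>A_special\<close> has been eliminated; the factor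
      \<open>poly B_special z\<close> is nonzero and cancels.\<close>
    ultimately have "(s * poly C1 z + t * 1690072) * poly B_special z = 0"
      by algebra
    then show ?thesis
      using p B_nonzero_at_roots_p[OF p] by (simp add: eq_neg_iff_add_eq_0)
  qed
  have "q \<noteq> 0" and ndeg: "degree q \<noteq> 0"
    using assms(2) by auto
  obtain a where a: "poly q a = 0"
    using ndeg fundamental_theorem_of_algebra[of q] constant_degree[of q] by auto
  obtain r where r: "q = [:- a, 1:] * r"
    using a unfolding poly_eq_0_iff_dvd by (rule dvdE)
  with \<open>q \<noteq> 0\<close> have "r \<noteq> 0" by auto
  then have "degree q = degree r + 1"
    unfolding r by (subst degree_mult_eq) auto
  \<comment> \<open>After one linear factor is removed the degree is still positive, so there is a
    second root, possibly equal to \<open>a\<close>.\<close>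
  with assms(2) obtain b where b: "poly r b = 0"
    using fundamental_theorem_of_algebra[of r] constant_degree[of r] by auto
  then have qb: "poly q b = 0"
    by (simp add: r)
  \<comment> \<open>For \<open>s = 0\<close> the relation at \<open>a\<close> would give
    \<open>t = 0\<close> as well.\<close>
  have "s \<noteq> 0"
    using dvd_root[OF a] assms(1) by auto
  then have "poly C1 a = poly C1 b"
    using dvd_root[OF a] dvd_root[OF qb] by (metis mult_left_cancel)
  then have "a = b"
    using C_separates_roots_p dvd_root[OF a] dvd_root[OF qb] by blast
  have "[:- a, 1:] dvd r"
    using b unfolding \<open>a = b\<close> poly_eq_0_iff_dvd .
  then have "[:- a, 1:] ^ 2 dvd q"
    unfolding power2_eq_square r by (rule mult_dvd_mono[OF dvd_refl])
  then have "[:- a, 1:] ^ 2 dvd p_special"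
    using assms(3) by (rule dvd_trans)
  moreover have "p_special \<noteq> 0"
    by (simp add: p_special_def)
  ultimately have "2 \<le> order a p_special"
    unfolding order_divides by simp
  moreover have "order a p_special = 0 \<or> order a p_special = 1"
    using rsquarefree_p unfolding rsquarefree_def by blast
  ultimately show False
    by linarith
qed

text \<open>As \<open>f\<close> attains the degree \<open>m\<close>, it has no zero at infinity, and
  the bound on \<open>r\<close> forces \<open>q\<close> to have degree \<open>k\<close>.\<close>

lemma common_form_factor2_degree_ge_2:
  assumes "common_form_factor2 m n f u" "degree f = m" "f \<noteq> 0"
  obtains q where "2 \<le> degree q" "q dvd f" "q dvd u"
proof -
  obtain k q r r' where *: "2 \<le> k" "k \<le> m" "degree q \<le> k" "degree r \<le> m - k" "f = q * r" "u = q * r'"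
    using assms(1) unfolding common_form_factor2_def by blast
  with assms have "degree q + degree r = m"
    by (metis degree_mult_eq mult_eq_0_iff)
  with * that[of q] show ?thesis
    by auto
qed

lemma Phi_special_nonzero:
  assumes "is_Phi 8 9 \<Phi>"
  shows "triple_form_eval \<Phi> (polyP f2_special f3_special f4_special)
    (polyA f2_special f3_special f4_special) (polyB f2_special f3_special f4_special) \<noteq> 0"
proof -
  let ?P = "polyP f2_special f3_special f4_special"
  let ?A = "polyA f2_special f3_special f4_special"
  let ?B = "polyB f2_special f3_special f4_special"
  have sep: "separable_poly ?P"
    using rsquarefree_p by (simp add: separable_poly_def cpoly_special rsquarefree_roots pderiv_smult)
  \<comment> \<open>The constant terms are 0 and -22, so the weight of \<open>?B\<close> must
    vanish, and then that of \<open>?A\<close>.\<close>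
  have indep: "lin_indep2 ?A ?B"
    by (simp add: lin_indep2_def polyA_special polyB_special)
  have deg: "degree ?P = 8" "degree ?A \<le> 9" "degree ?B \<le> 9"
    by (simp_all add: polyP_special polyA_special polyB_special)
  have False
    if "(s, t) \<noteq> (0, 0)"
      and cf: "common_form_factor2 8 9 (cpoly ?P) (smult s (cpoly ?A) + smult t (cpoly ?B))"
    for s t
  proof -
    have "degree (cpoly ?P) = 8" "cpoly ?P \<noteq> 0"
      by (simp_all add: cpoly_special p_special_def)
    then obtain q where "2 \<le> degree q" "q dvd cpoly ?P" "q dvd smult s (cpoly ?A) + smult t (cpoly ?B)"
      using cf common_form_factor2_degree_ge_2 by blast
    then show False
      \<comment> \<open>Divisibility ignores the unit 4 by which \<open>cpoly ?P\<close> differs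
        from \<open>p_special\<close>.\<close>
      using no_common_factor_special[of s t q] that(1)
      by (simp add: cpoly_special dvd_smult_iff)
  qed
  then show ?thesis
    using assms[unfolded is_Phi_def, THEN conjunct2, rule_format, of ?P ?A ?B] sep indep deg
    by auto
qed

theorem mainTheorem2:
  fixes \<Phi> :: triple_form
  assumes "is_Phi 8 9 \<Phi>"
  shows
    "(\<forall>f2 f3 f4 :: real poly. degree f2 \<le> 2 \<and> degree f3 \<le> 3 \<and> degree f4 \<le> 4 \<longrightarrow>
        degree (polyP f2 f3 f4) \<le> 8 \<and> degree (polyA f2 f3 f4) \<le> 9 \<and> degree (polyB f2 f3 f4) \<le> 9) \<and>
     (let f2 = [:-1, 0, 2:] :: real poly;
          f3 = [:1, -2, -1, 2:] :: real poly;
          f4 = [:1, 1, -2, 1, 1:] :: real poly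
      in triple_form_eval \<Phi> (polyP f2 f3 f4) (polyA f2 f3 f4) (polyB f2 f3 f4) \<noteq> 0) \<and>
     (let F2 = generic_poly 2; F3 = generic_poly 3; F4 = generic_poly 4
      in triple_form_eval \<Phi> (polyP F2 F3 F4) (polyA F2 F3 F4) (polyB F2 F3 F4) \<noteq> 0)"
proof -
  \<comment> \<open>The specialization decodes a variable number into polynomial index and exponent;
    every index other than 2 and 3 defaults to \<open>f4_special\<close>.\<close>
  define c :: "nat \<Rightarrow> real" where
    "c v = (case prod_decode v of (i, k) \<Rightarrow>
      coeff (if i = 2 then f2_special else if i = 3 then f3_special else f4_special) k)" for v
  have hom: "ring_hom_fun (mpoly_eval c)"
    by (rule ring_hom_fun_mpoly_eval)
  have gen: "map_poly (mpoly_eval c) (generic_poly 2) = f2_special"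
    "map_poly (mpoly_eval c) (generic_poly 3) = f3_special"
    "map_poly (mpoly_eval c) (generic_poly 4) = f4_special"
    by (rule map_poly_generic_poly; simp add: c_def)+
  have "mpoly_eval c (triple_form_eval \<Phi> (polyP (generic_poly 2) (generic_poly 3) (generic_poly 4))
      (polyA (generic_poly 2) (generic_poly 3) (generic_poly 4))
      (polyB (generic_poly 2) (generic_poly 3) (generic_poly 4))) \<noteq> 0"
    unfolding hom_triple_form_eval[OF hom] map_poly_polyP_polyA_polyB[OF hom] gen
    by (rule Phi_special_nonzero[OF assms])
  then have generic: "triple_form_eval \<Phi> (polyP (generic_poly 2) (generic_poly 3) (generic_poly 4))
      (polyA (generic_poly 2) (generic_poly 3) (generic_poly 4))
      (polyB (generic_poly 2) (generic_poly 3) (generic_poly 4)) \<noteq> 0"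
    \<comment> \<open>A homomorphism sends 0 to 0, so a nonzero image has a nonzero
      preimage.\<close>
    using hom_simps(4)[OF hom] by metis
  show ?thesis
    unfolding Let_def
    by (intro conjI allI impI; (elim conjE)?;
        (rule Phi_special_nonzero[OF assms] generic degree_polyP_polyA_polyB_le; assumption?))
qed

end
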